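(* Let $X,U$ be nonempty sets, $f:X\times U\to X$, $\sigma:X\to\mathbb{R}_{\ge 0}$ and $\rho:U\to\mathbb{R}_{\ge 0}$ arbitrary functions, and consider the system $x_+=f(x,u)$. Let $\mathbb{X}\subseteq X$, let $\ell(x,u)=q(\sigma(x))+r(\rho(u))$ with $q\in\mathcal{K}_\infty$ and $r:\mathbb{R}_{\ge 0}\to\mathbb{R}_{\ge 0}$, and let $\bar\alpha\in\mathcal{K}_\infty$, such that for all $x\in\mathbb{X}$ there exists $u\in U^\infty$ with (a) $\phi(n;x,u)\in\mathbb{X}$ for all $n\ge 0$, and (b) $J_\infty(x,u\mid\ell)\le\bar\alpha(\sigma(x))$. Then there exist $\beta\in\mathcal{KL}$, $\eta:\mathbb{R}_{\ge 0}\to\mathbb{R}_{\ge 0}$ and $\gamma\in\mathcal{K}_\infty$ such that for all $x\in\mathbb{X}$ there exists $u_x\in U^\infty$ with (i) $\sigma(\phi(n;x,u_x))\le\beta(\sigma(x),n)$ for all $n\ge 0$, and (ii) $\sum_{n=0}^{N-1}\eta(\rho(u_x(n)))\le\gamma(\sigma(x))$ for all $N\ge 1$. If $r\in\mathcal{K}_\infty$, then $\eta$ can be chosen in $\mathcal{K}_\infty$, i.e., the system is uniformly asymptotically controllable with uniformly bounded generalized energy controls (UACwUBgEC) on $\mathbb{X}$.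
   Context: $\mathbb{N}=\{0,1,2,\dots\}$ and $U^\infty=U^{\mathbb{N}}$ is the set of infinite input sequences. Trajectories: $\phi(0;x,u)=x$, $\phi(n+1;x,u)=f(\phi(n;x,u),u(n))$ for $n\ge 0$. For a stage cost $\ell:X\times U\to\mathbb{R}_{\ge 0}$, set $J_\infty(x,u\mid\ell)=\sum_{n=0}^{\infty}\ell(\phi(n;x,u),u(n))\in[0,\infty]$. Comparison functions: $\mathcal{K}$ is the set of continuous strictly increasing $\alpha:\mathbb{R}_{\ge 0}\to\mathbb{R}_{\ge 0}$ with $\alpha(0)=0$; $\mathcal{K}_\infty$ is the set of $\alpha\in\mathcal{K}$ with $\lim_{s\to\infty}\alpha(s)=\infty$; $\mathcal{KL}$ is the set of continuous $\beta:\mathbb{R}_{\ge 0}\times\mathbb{R}_{\ge 0}\to\mathbb{R}_{\ge 0}$ such that $\beta(\cdot,t)\in\mathcal{K}_\infty$ for all $t\ge 0$, and for all $s>0$ the function $\beta(s,\cdot)$ is strictly decreasing with $\lim_{t\to\infty}\beta(s,t)=0$. The system is UACwUBgEC on $\mathbb{X}$ if there exist $\beta\in\mathcal{KL}$ and $\eta,\gamma\in\mathcal{K}_\infty$ such that for all $x\in\mathbb{X}$ there exists $u_x\in U^\infty$ with $\sigma(\phi(n;x,u_x))\le\beta(\sigma(x),n)$ for all $n\ge 0$ and $\sum_{n=0}^{N-1}\eta(\rho(u_x(n)))\le\gamma(\sigma(x))$ for all $N\ge 1$. *)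

theory Defs
  imports "HOL-Analysis.Analysis"
begin

text \<open>Functions on the nonnegative reals are represented by functions on all reals;
  every condition concerns arguments in \<open>{0..}\<close> only.\<close>

definition class_K :: "(real \<Rightarrow> real) set" where
  "class_K = {\<alpha>. \<alpha> \<in> {0..} \<rightarrow> {0..} \<and> continuous_on {0..} \<alpha> \<and> strict_mono_on {0..} \<alpha> \<and> \<alpha> 0 = 0}"

definition class_K_inf :: "(real \<Rightarrow> real) set" where
  "class_K_inf = {\<alpha> \<in> class_K. filterlim \<alpha> at_top at_top}"

definition class_KL :: "(real \<Rightarrow> real \<Rightarrow> real) set" where
  "class_KL = {\<beta>.
     continuous_on ({0..} \<times> {0..}) (\<lambda>(s, t). \<beta> s t) \<and>
     (\<forall>t\<ge>0. (\<lambda>s. \<beta> s t) \<in> class_K_inf) \<and>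
     (\<forall>s>0. strict_antimono_on {0..} (\<beta> s) \<and> (\<beta> s \<longlongrightarrow> 0) at_top)}"

primrec traj :: "('x \<Rightarrow> 'u \<Rightarrow> 'x) \<Rightarrow> nat \<Rightarrow> 'x \<Rightarrow> (nat \<Rightarrow> 'u) \<Rightarrow> 'x" where
  "traj f 0 x u = x"
| "traj f (Suc n) x u = f (traj f n x u) (u n)"

text \<open>The stage cost \<open>l\<close> is meant to be nonnegative; \<open>ennreal\<close> would replace negative values by 0.\<close>

definition J_inf :: "('x \<Rightarrow> 'u \<Rightarrow> 'x) \<Rightarrow> ('x \<Rightarrow> 'u \<Rightarrow> real) \<Rightarrow> 'x \<Rightarrow> (nat \<Rightarrow> 'u) \<Rightarrow> ennreal" where
  "J_inf f l x u = (\<Sum>n. ennreal (l (traj f n x u) (u n)))"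

text \<open>Uniform asymptotic controllability with uniformly bounded generalized energy controls.\<close>

definition UACwUBgEC ::
    "('x \<Rightarrow> 'u \<Rightarrow> 'x) \<Rightarrow> ('x \<Rightarrow> real) \<Rightarrow> ('u \<Rightarrow> real) \<Rightarrow> 'x set \<Rightarrow> bool" where
  "UACwUBgEC f \<sigma> \<rho> XX \<longleftrightarrow>
     (\<exists>\<beta>\<in>class_KL. \<exists>\<eta>\<in>class_K_inf. \<exists>\<gamma>\<in>class_K_inf. \<forall>x\<in>XX. \<exists>u.
        (\<forall>n. \<sigma> (traj f n x u) \<le> \<beta> (\<sigma> x) (real n)) \<and>
        (\<forall>N\<ge>1. (\<Sum>n<N. \<eta> (\<rho> (u n))) \<le> \<gamma> (\<sigma> x)))"

end

theory Submission
  imports Defs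
begin

text \<open>
  Switching controls turns the summability of the costs into a uniform rate of decay.
  Call a control from \<open>x\<close> good if its trajectory stays in \<open>XX\<close> and its cost is at most
  \<open>\<alpha> (\<sigma> x)\<close>.  Follow a good control as long as its tail is good from the current
  state, and otherwise switch to some good control from that state.  The trajectory of the tail stays in
  \<open>XX\<close>, so it can only fail to be good by being too expensive; hence a switch lowers the
  remaining cost.  Therefore (lemma \<open>restarted_control\<close>), along the
  resulting trajectory \<open>x\<^sub>n\<close> with controls \<open>u\<^sub>n\<close> the remaining costs \<open>J\<^sub>n\<close> satisfy
  \<open>l x\<^sub>n u\<^sub>n + J\<^sub>n\<^sub>+\<^sub>1 \<le> J\<^sub>n \<le> \<alpha> (\<sigma> x\<^sub>n)\<close>.

  Summing up, the total cost is at most \<open>J\<^sub>0 \<le> \<alpha> s\<close> with \<open>s = \<sigma> x\<close>, which gives the energy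
  bound with \<open>\<eta> = r\<close> and \<open>\<gamma> = \<alpha>\<close>.  Moreover, among the times \<open>0, \<dots>, n\<close>
  there is one, \<open>i\<close>, whose stage cost is at most the average \<open>\<alpha> s / (n + 1)\<close>.  There
  \<open>q (\<sigma> x\<^sub>i) \<le> \<alpha> s / (n + 1)\<close>, and since \<open>J\<close> decreases,
  \<open>q (\<sigma> x\<^sub>n) \<le> J\<^sub>n \<le> J\<^sub>i \<le> \<alpha> (\<sigma> x\<^sub>i)\<close>.  With \<open>p\<close> the inverse of \<open>q\<close>, this is
  \<open>\<sigma> x\<^sub>n \<le> p (\<alpha> (p (\<alpha> s / (1 + n))))\<close>, and the right-hand side is an explicit
  function of class KL (lemma \<open>class_KL_of_class_K_inf\<close>).
\<close>

section \<open>Comparison functions\<close>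

lemma class_KD:
  assumes "\<alpha> \<in> class_K"
  shows "\<alpha> \<in> {0..} \<rightarrow> {0..}" "continuous_on {0..} \<alpha>" "\<alpha> 0 = 0"
    "\<And>x. 0 \<le> x \<Longrightarrow> 0 \<le> \<alpha> x"
    "\<And>x y. 0 \<le> x \<Longrightarrow> 0 \<le> y \<Longrightarrow> \<alpha> x < \<alpha> y \<longleftrightarrow> x < y"
    "\<And>x y. 0 \<le> x \<Longrightarrow> 0 \<le> y \<Longrightarrow> \<alpha> x \<le> \<alpha> y \<longleftrightarrow> x \<le> y"
  using assms by (auto simp: class_K_def strict_mono_on_less strict_mono_on_less_eq Pi_iff)

lemma class_K_infD:
  assumes "\<alpha> \<in> class_K_inf"
  shows "\<alpha> \<in> class_K" "filterlim \<alpha> at_top at_top"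
  using assms by (auto simp: class_K_inf_def)

lemma class_K_inf_image:
  assumes "\<alpha> \<in> class_K_inf"
  shows "\<alpha> ` {0..} = {0..}"
proof
  note K = class_KD[OF class_K_infD(1)[OF assms]]
  show "\<alpha> ` {0..} \<subseteq> {0..}"
    using K(4) by auto
  show "{0..} \<subseteq> \<alpha> ` {0..}"
  proof
    fix y :: real
    assume y: "y \<in> {0..}"
    have "\<forall>\<^sub>F x in at_top. y \<le> \<alpha> x \<and> 0 \<le> x"
      using class_K_infD(2)[OF assms] eventually_ge_at_top
      by (auto simp: filterlim_at_top eventually_conj_iff)
    then obtain b where b: "y \<le> \<alpha> b" "0 \<le> b"
      by (auto simp: eventually_at_top_linorder)
    have "\<exists>x. 0 \<le> x \<and> x \<le> b \<and> \<alpha> x = y"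
    proof (rule IVT')
      show "continuous_on {0..b} \<alpha>"
        using K(2) by (rule continuous_on_subset) auto
    qed (use b y K(3) in auto)
    then show "y \<in> \<alpha> ` {0..}"
      by auto
  qed
qed

lemma class_K_inf_inverse:
  assumes "\<alpha> \<in> class_K_inf"
  obtains p where "p \<in> class_K_inf" "\<And>x. 0 \<le> x \<Longrightarrow> p (\<alpha> x) = x" "\<And>y. 0 \<le> y \<Longrightarrow> \<alpha> (p y) = y"
proof -
  note K = class_KD[OF class_K_infD(1)[OF assms]]
  have "inj_on \<alpha> {0..}"
    using assms by (auto simp: class_K_inf_def class_K_def intro: strict_mono_on_imp_inj_on)
  then obtain p where "homeomorphism {0..} (\<alpha> ` {0..}) \<alpha> p"
    using homeomorphism_into_1d[of "{0::real..}" \<alpha>] K(2) is_interval_path_connected[OF is_interval_ci]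
    by blast
  then have hom: "homeomorphism {0..} {0..} \<alpha> p"
    by (simp add: class_K_inf_image[OF assms])
  then have pa: "p (\<alpha> x) = x" and ap: "\<alpha> (p x) = x" and p0: "0 \<le> p x" if "0 \<le> x" for x
    using that unfolding homeomorphism_def by auto
  have mono: "p x < p y \<longleftrightarrow> x < y" if "0 \<le> x" "0 \<le> y" for x y
    using K(5)[OF p0 p0, of x y] ap that by simp
  have "p 0 = 0"
    using pa[of 0] K(3) by simp
  moreover have "filterlim p at_top at_top"
    unfolding filterlim_at_top_gt[where c = 0]
  proof (intro allI impI)
    fix Z :: real
    assume Z: "Z > 0"
    show "\<forall>\<^sub>F x in at_top. Z \<le> p x"
      using eventually_ge_at_top[of "\<alpha> Z"]
    proof eventually_elim
      case (elim x)
      have "0 \<le> x"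
        using elim K(4)[of Z] Z by simp
      then show ?case
        using elim mono[of x "\<alpha> Z"] pa[of Z] Z K(4)[of Z] by auto
    qed
  qed
  ultimately have "p \<in> class_K_inf"
    using hom p0 mono
    by (auto simp: class_K_inf_def class_K_def homeomorphism_def intro: strict_mono_onI)
  with pa ap show ?thesis
    using that by blast
qed

lemma class_K_inf_comp:
  assumes "\<alpha> \<in> class_K_inf" "\<beta> \<in> class_K_inf"
  shows "(\<lambda>s. \<alpha> (\<beta> s)) \<in> class_K_inf"
proof -
  note A = class_K_infD[OF assms(1)] and B = class_K_infD[OF assms(2)]
  have "continuous_on {0..} (\<lambda>s. \<alpha> (\<beta> s))"
    using class_KD(4)[OF B(1)]
    by (intro continuous_on_compose2[OF class_KD(2)[OF A(1)] class_KD(2)[OF B(1)]]) auto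
  moreover have "strict_mono_on {0..} (\<lambda>s. \<alpha> (\<beta> s))"
    by (intro strict_mono_onI) (simp add: class_KD(4,5)[OF A(1)] class_KD(4,5)[OF B(1)])
  moreover have "(\<lambda>s. \<alpha> (\<beta> s)) \<in> {0..} \<rightarrow> {0..}"
    by (simp add: class_KD(4)[OF A(1)] class_KD(4)[OF B(1)])
  ultimately show ?thesis
    using filterlim_compose[OF A(2) B(2)] class_KD(3)[OF A(1)] class_KD(3)[OF B(1)]
    by (simp add: class_K_inf_def class_K_def)
qed

lemma class_K_inf_divide:
  assumes "\<alpha> \<in> class_K_inf" "c > 0"
  shows "(\<lambda>s. \<alpha> s / c) \<in> class_K_inf"
proof -
  note A = class_K_infD[OF assms(1)]
  have "filterlim (\<lambda>s. \<alpha> s / c) at_top at_top"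
    using filterlim_tendsto_pos_mult_at_top[OF tendsto_const[of "1 / c"] _ A(2)] assms(2) by simp
  moreover have "continuous_on {0..} (\<lambda>s. \<alpha> s / c)"
    using class_KD(2)[OF A(1)] assms(2) by (intro continuous_on_divide continuous_on_const) auto
  moreover have "strict_mono_on {0..} (\<lambda>s. \<alpha> s / c)"
    by (intro strict_mono_onI) (simp add: class_KD(5)[OF A(1)] assms(2) divide_strict_right_mono)
  moreover have "(\<lambda>s. \<alpha> s / c) \<in> {0..} \<rightarrow> {0..}"
    using assms(2) by (simp add: class_KD(4)[OF A(1)])
  ultimately show ?thesis
    by (simp add: class_K_inf_def class_K_def class_KD(3)[OF A(1)])
qed

lemma class_KL_of_class_K_inf:
  assumes "\<alpha> \<in> class_K_inf" "\<kappa> \<in> class_K_inf"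
  shows "(\<lambda>s t. \<kappa> (\<alpha> s / (1 + t))) \<in> class_KL"
proof -
  note A = class_KD[OF class_K_infD(1)[OF assms(1)]]
    and G = class_KD[OF class_K_infD(1)[OF assms(2)]]
  have "continuous_on ({0..} \<times> {0..}) (\<lambda>z. \<kappa> (\<alpha> (fst z) / (1 + snd z)))"
  proof (intro continuous_on_compose2[OF G(2)] continuous_intros)
    show "continuous_on ({0..} \<times> {0..}) (\<lambda>z. \<alpha> (fst z))"
      by (intro continuous_on_compose2[OF A(2)] continuous_intros) auto
  qed (auto intro!: divide_nonneg_pos A(4))
  moreover have "(\<lambda>s. \<kappa> (\<alpha> s / (1 + t))) \<in> class_K_inf" if "0 \<le> t" for t
    using class_K_inf_comp[OF assms(2) class_K_inf_divide[OF assms(1)]] that by simp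
  moreover have "strict_antimono_on {0..} (\<lambda>t. \<kappa> (\<alpha> s / (1 + t)))
      \<and> ((\<lambda>t. \<kappa> (\<alpha> s / (1 + t))) \<longlongrightarrow> 0) at_top" if "s > 0" for s
  proof
    have pos: "\<alpha> s > 0"
      using A(5)[of 0 s] A(3) that by simp
    then show "strict_antimono_on {0..} (\<lambda>t. \<kappa> (\<alpha> s / (1 + t)))"
      by (intro monotone_onI) (simp add: G(5) divide_strict_left_mono)
    have "filterlim (\<lambda>t::real. 1 + t) at_top at_top"
      by (intro filterlim_tendsto_add_at_top[OF tendsto_const] filterlim_ident)
    then have "((\<lambda>t. \<alpha> s / (1 + t)) \<longlongrightarrow> 0) at_top"
      by (intro real_tendsto_divide_at_top[OF tendsto_const])
    then have "((\<lambda>t. \<kappa> (\<alpha> s / (1 + t))) \<longlongrightarrow> \<kappa> 0) at_top"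
    proof (rule continuous_on_tendsto_compose[OF G(2)])
      show "\<forall>\<^sub>F t in at_top. \<alpha> s / (1 + t) \<in> {0..}"
        using eventually_ge_at_top[of 0] by eventually_elim (use pos in auto)
    qed simp
    then show "((\<lambda>t. \<kappa> (\<alpha> s / (1 + t))) \<longlongrightarrow> 0) at_top"
      by (simp add: G(3))
  qed
  ultimately show ?thesis
    by (auto simp: class_KL_def case_prod_beta)
qed

section \<open>Switching between controls\<close>

lemma traj_shift: "traj f n (f x (u 0)) (\<lambda>i. u (Suc i)) = traj f (Suc n) x u"
  by (induction n) auto

lemma J_inf_shift:
  "J_inf f l x u = ennreal (l x (u 0)) + J_inf f l (f x (u 0)) (\<lambda>i. u (Suc i))"
proof -
  have "J_inf f l x u = (\<Sum>n. ennreal (l (traj f (n + 1) x u) (u (n + 1))))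
      + (\<Sum>n<1. ennreal (l (traj f n x u) (u n)))"
    unfolding J_inf_def by (rule suminf_offset) auto
  then show ?thesis
    by (simp add: J_inf_def traj_shift add.commute del: traj.simps(2))
qed

text \<open>In the construction, \<open>J n\<close> is the cost from time \<open>n\<close> on if the control followed at
  time \<open>n\<close> is kept for good.  Storing that control next to the state makes the switching rule
  memoryless, so the run is obtained by dependent choice.\<close>

lemma restarted_control:
  fixes V :: "'x \<Rightarrow> ennreal"
  assumes ex: "\<And>x. x \<in> XX \<Longrightarrow> \<exists>u. (\<forall>n. traj f n x u \<in> XX) \<and> J_inf f l x u \<le> V x"
    and x: "x \<in> XX"
  obtains u J where "\<And>n. J n \<le> V (traj f n x u)"
    "\<And>n. ennreal (l (traj f n x u) (u n)) + J (Suc n) \<le> J n"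
proof -
  define good where "good z \<longleftrightarrow> (\<forall>n. traj f n (fst z) (snd z) \<in> XX)
      \<and> J_inf f l (fst z) (snd z) \<le> V (fst z)" for z
  define succ where "succ z z' \<longleftrightarrow> fst z' = f (fst z) (snd z 0)
      \<and> ennreal (l (fst z) (snd z 0)) + J_inf f l (fst z') (snd z') \<le> J_inf f l (fst z) (snd z)"
    for z z'
  have "\<exists>w. \<forall>n. (good (w n) \<and> (n = 0 \<longrightarrow> fst (w n) = x)) \<and> succ (w n) (w (Suc n))"
  proof (rule dependent_nat_choice)
    show "\<exists>z. good z \<and> (0 = (0::nat) \<longrightarrow> fst z = x)"
      using ex[OF x] by (auto simp: good_def)
  next
    fix z and n :: nat
    assume z: "good z \<and> (n = 0 \<longrightarrow> fst z = x)"
    obtain y v where zyv: "z = (y, v)"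
      by fastforce
    let ?y = "f y (v 0)" and ?v = "\<lambda>i. v (Suc i)"
    have tail: "traj f n ?y ?v \<in> XX" for n
      using z zyv by (auto simp: good_def traj_shift simp del: traj.simps(2))
    show "\<exists>z'. (good z' \<and> (Suc n = 0 \<longrightarrow> fst z' = x)) \<and> succ z z'"
    proof (cases "J_inf f l ?y ?v \<le> V ?y")
      case True
      then show ?thesis
        using tail zyv J_inf_shift[of f l y v]
        by (intro exI[of _ "(?y, ?v)"]) (auto simp: good_def succ_def)
    next
      case False
      obtain v' where v': "\<And>n. traj f n ?y v' \<in> XX" "J_inf f l ?y v' \<le> V ?y"
        using ex[of ?y] tail[of 0] by auto
      \<comment> \<open>the control \<open>v'\<close> is cheaper than the tail \<open>?v\<close>, whose cost exceeds \<open>V ?y\<close>\<close>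
      have "J_inf f l ?y v' \<le> J_inf f l ?y ?v"
        using v'(2) False by simp
      then show ?thesis
        using v' zyv J_inf_shift[of f l y v]
        by (intro exI[of _ "(?y, v')"]) (auto simp: good_def succ_def intro: add_left_mono)
    qed
  qed
  then obtain w where "\<forall>n. (good (w n) \<and> (n = 0 \<longrightarrow> fst (w n) = x)) \<and> succ (w n) (w (Suc n))" ..
  then have w: "good (w n)" "fst (w 0) = x" "succ (w n) (w (Suc n))" for n
    by auto
  define u where "u n = snd (w n) 0" for n
  have tr: "traj f n x u = fst (w n)" for n
    by (induction n) (use w in \<open>auto simp: succ_def u_def\<close>)
  show ?thesis
  proof (rule that[of "\<lambda>n. J_inf f l (fst (w n)) (snd (w n))" u])
    show "J_inf f l (fst (w n)) (snd (w n)) \<le> V (traj f n x u)" for n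
      using w(1)[of n] by (simp add: good_def tr)
    show "ennreal (l (traj f n x u) (u n)) + J_inf f l (fst (w (Suc n))) (snd (w (Suc n)))
        \<le> J_inf f l (fst (w n)) (snd (w n))" for n
      using w(3)[of n] unfolding succ_def tr u_def by (rule conjunct2)
  qed
qed

lemma sum_add_le_of_telescoping:
  fixes J c :: "nat \<Rightarrow> 'a :: ordered_comm_monoid_add"
  assumes "\<And>n. c n + J (Suc n) \<le> J n"
  shows "sum c {..<n} + J n \<le> J 0"
proof (induction n)
  case (Suc n)
  have "sum c {..<Suc n} + J (Suc n) = sum c {..<n} + (c n + J (Suc n))"
    by (simp add: add.assoc)
  also have "\<dots> \<le> sum c {..<n} + J n"
    using assms by (rule add_left_mono)
  finally show ?case
    using Suc.IH by order
qed simp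

text \<open>The hypothesis \<open>p\<close> says that \<open>p\<close> is the inverse of \<open>q\<close>.\<close>

lemma restarted_control_bounds:
  fixes \<sigma> :: "'x \<Rightarrow> real" and l :: "'x \<Rightarrow> 'u \<Rightarrow> real"
  assumes q: "q \<in> class_K" and \<alpha>: "\<alpha> \<in> class_K"
    and p: "\<And>y. 0 \<le> y \<Longrightarrow> 0 \<le> p y" "\<And>y. 0 \<le> y \<Longrightarrow> q (p y) = y"
    and \<sigma>: "\<And>x. 0 \<le> \<sigma> x" and l: "\<And>x u. q (\<sigma> x) \<le> l x u"
    and ex: "\<And>x. x \<in> XX \<Longrightarrow>
           \<exists>u. (\<forall>n. traj f n x u \<in> XX) \<and> J_inf f l x u \<le> ennreal (\<alpha> (\<sigma> x))"
    and x: "x \<in> XX"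
  obtains u where "\<And>n. \<sigma> (traj f n x u) \<le> p (\<alpha> (p (\<alpha> (\<sigma> x) / (1 + real n))))"
    "\<And>N. (\<Sum>n<N. l (traj f n x u) (u n)) \<le> \<alpha> (\<sigma> x)"
proof -
  note Q = class_KD[OF q] and A = class_KD[OF \<alpha>]
  obtain u J where J: "\<And>n. J n \<le> ennreal (\<alpha> (\<sigma> (traj f n x u)))"
    and step: "\<And>n. ennreal (l (traj f n x u) (u n)) + J (Suc n) \<le> J n"
    by (rule restarted_control[of XX f l "\<lambda>x. ennreal (\<alpha> (\<sigma> x))" x, OF ex x])
      (assumption | (rule that; assumption))+
  define c where "c n = l (traj f n x u) (u n)" for n
  define s where "s n = \<sigma> (traj f n x u)" for n
  have s0: "0 \<le> s n" for n
    by (simp add: s_def \<sigma>)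
  have c: "q (s n) \<le> c n" for n
    by (simp add: s_def c_def l)
  have c0: "0 \<le> c n" for n
    by (rule order_trans[OF Q(4)[OF s0] c])
  have sum_c: "sum c {..<N} \<le> \<alpha> (s 0)" for N
  proof -
    have "(\<Sum>n<N. ennreal (c n)) \<le> (\<Sum>n<N. ennreal (c n)) + J N"
      by simp
    also have "\<dots> \<le> J 0"
      by (rule sum_add_le_of_telescoping) (simp add: c_def step)
    also have "\<dots> \<le> ennreal (\<alpha> (s 0))"
      using J[of 0] by (simp add: s_def)
    finally show ?thesis
      using c0 A(4)[OF s0] by simp
  qed
  have "decseq J"
  proof (rule decseq_SucI)
    show "J (Suc n) \<le> J n" for n
      using step[of n] by (rule order_trans[rotated]) simp
  qed
  have "s n \<le> p (\<alpha> (p (\<alpha> (s 0) / (1 + real n))))" for n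
  proof -
    define b where "b = \<alpha> (s 0) / (1 + real n)"
    have b0: "0 \<le> b"
      using A(4)[OF s0] by (simp add: b_def)
    have "\<exists>i\<le>n. c i \<le> b"
    proof (rule ccontr)
      assume "\<not> ?thesis"
      then have "b < c i" if "i \<in> {..<Suc n}" for i
        using that by (meson lessThan_iff less_Suc_eq_le not_le)
      then have "(\<Sum>i<Suc n. b) < sum c {..<Suc n}"
        by (intro sum_strict_mono) auto
      moreover have "(\<Sum>i<Suc n. b) = \<alpha> (s 0)"
        by (simp add: b_def)
      ultimately show False
        using sum_c[of "Suc n"] by linarith
    qed
    then obtain i where i: "i \<le> n" "c i \<le> b"
      by blast
    have "q (s i) \<le> q (p b)"
      using c[of i] i(2) p(2)[OF b0] by simp
    then have si: "s i \<le> p b"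
      using Q(6) s0 p(1)[OF b0] by simp
    have "ennreal (q (s n)) \<le> ennreal (c n)"
      by (rule ennreal_leI) (rule c)
    also have "\<dots> \<le> J n"
      using step[of n] unfolding c_def by (rule order_trans[rotated]) simp
    also have "\<dots> \<le> J i"
      using \<open>decseq J\<close> i(1) by (simp add: decseq_def)
    also have "\<dots> \<le> ennreal (\<alpha> (s i))"
      using J by (simp add: s_def)
    finally have "q (s n) \<le> \<alpha> (s i)"
      using A(4)[OF s0] by simp
    also have "\<dots> \<le> \<alpha> (p b)"
      using A(6) s0 p(1)[OF b0] si by simp
    also have "\<dots> = q (p (\<alpha> (p b)))"
      using p A(4) b0 by simp
    finally show ?thesis
      using Q(6)[OF s0 p(1)[OF A(4)[OF p(1)[OF b0]]]] by (simp add: b_def)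
  qed
  then show ?thesis
    using sum_c by (intro that[of u]) (simp_all add: s_def c_def)
qed

theorem theorem3:
  fixes f :: "'x \<Rightarrow> 'u \<Rightarrow> 'x"
    and \<sigma> :: "'x \<Rightarrow> real"
    and \<rho> :: "'u \<Rightarrow> real"
    and XX :: "'x set"
    and l :: "'x \<Rightarrow> 'u \<Rightarrow> real"
    and q r \<alpha> :: "real \<Rightarrow> real"
  assumes "\<And>x. \<sigma> x \<ge> 0"
    and "\<And>u. \<rho> u \<ge> 0"
    and "q \<in> class_K_inf"
    and "r \<in> {0..} \<rightarrow> {0..}"
    and "\<And>x u. l x u = q (\<sigma> x) + r (\<rho> u)"
    and "\<alpha> \<in> class_K_inf"
    and "\<And>x. x \<in> XX \<Longrightarrow>
           \<exists>u. (\<forall>n. traj f n x u \<in> XX) \<and> J_inf f l x u \<le> ennreal (\<alpha> (\<sigma> x))"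
  shows "(\<exists>\<beta>\<in>class_KL. \<exists>\<eta>\<in>{0..} \<rightarrow> {0..}. \<exists>\<gamma>\<in>class_K_inf. \<forall>x\<in>XX. \<exists>u.
            (\<forall>n. \<sigma> (traj f n x u) \<le> \<beta> (\<sigma> x) (real n)) \<and>
            (\<forall>N\<ge>1. (\<Sum>n<N. \<eta> (\<rho> (u n))) \<le> \<gamma> (\<sigma> x)))
       \<and> (r \<in> class_K_inf \<longrightarrow> UACwUBgEC f \<sigma> \<rho> XX)"
proof -
  note \<sigma> = assms(1) and \<rho> = assms(2) and q = assms(3) and r = assms(4) and l = assms(5)
    and \<alpha> = assms(6) and ex = assms(7)
  obtain p where p: "p \<in> class_K_inf" "\<And>y. 0 \<le> y \<Longrightarrow> q (p y) = y"
    using class_K_inf_inverse[OF q] by blast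
  define \<beta> where "\<beta> = (\<lambda>s t. p (\<alpha> (p (\<alpha> s / (1 + t)))))"
  have \<beta>: "\<beta> \<in> class_KL"
    unfolding \<beta>_def
    using class_KL_of_class_K_inf[OF \<alpha> class_K_inf_comp[OF p(1) class_K_inf_comp[OF \<alpha> p(1)]]] .
  have q0: "0 \<le> q (\<sigma> x)" and r0: "0 \<le> r (\<rho> u)" for x u
    using class_KD(4)[OF class_K_infD(1)[OF q]] \<sigma> \<rho> r by auto
  have main: "\<forall>x\<in>XX. \<exists>u. (\<forall>n. \<sigma> (traj f n x u) \<le> \<beta> (\<sigma> x) (real n)) \<and>
      (\<forall>N\<ge>1. (\<Sum>n<N. r (\<rho> (u n))) \<le> \<alpha> (\<sigma> x))"
  proof
    fix x
    assume x: "x \<in> XX"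
    have l_ge: "q (\<sigma> x) \<le> l x u" for x u
      using r0 by (simp add: l)
    obtain u where u: "\<And>n. \<sigma> (traj f n x u) \<le> p (\<alpha> (p (\<alpha> (\<sigma> x) / (1 + real n))))"
        "\<And>N. (\<Sum>n<N. l (traj f n x u) (u n)) \<le> \<alpha> (\<sigma> x)"
      by (rule restarted_control_bounds[OF class_K_infD(1)[OF q] class_K_infD(1)[OF \<alpha>]
          class_KD(4)[OF class_K_infD(1)[OF p(1)]] p(2) \<sigma> l_ge ex x])
        (assumption | (rule that; assumption))+
    have "(\<Sum>n<N. r (\<rho> (u n))) \<le> \<alpha> (\<sigma> x)" for N
      using u(2)[of N] by (rule order_trans[rotated]) (auto simp: l q0 intro: sum_mono)
    then show "\<exists>u. (\<forall>n. \<sigma> (traj f n x u) \<le> \<beta> (\<sigma> x) (real n)) \<and>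
        (\<forall>N\<ge>1. (\<Sum>n<N. r (\<rho> (u n))) \<le> \<alpha> (\<sigma> x))"
      using u(1) by (intro exI[of _ u]) (auto simp: \<beta>_def)
  qed
  show ?thesis
  proof (intro conjI impI)
    show "\<exists>\<beta>\<in>class_KL. \<exists>\<eta>\<in>{0..} \<rightarrow> {0..}. \<exists>\<gamma>\<in>class_K_inf. \<forall>x\<in>XX. \<exists>u.
            (\<forall>n. \<sigma> (traj f n x u) \<le> \<beta> (\<sigma> x) (real n)) \<and>
            (\<forall>N\<ge>1. (\<Sum>n<N. \<eta> (\<rho> (u n))) \<le> \<gamma> (\<sigma> x))"
      by (rule bexI[OF _ \<beta>], rule bexI[OF _ r], rule bexI[OF _ \<alpha>]) (rule main)
    show "UACwUBgEC f \<sigma> \<rho> XX" if "r \<in> class_K_inf"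
      unfolding UACwUBgEC_def
      by (rule bexI[OF _ \<beta>], rule bexI[OF _ that], rule bexI[OF _ \<alpha>]) (rule main)
  qed
qed

end
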